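(* Let $\mathcal{B}$ be a Banach space, let $\mathcal{H}$ and $\mathcal{Z}$ be separable Hilbert spaces, let $\mathfrak{b}:\mathcal{H}\times\mathcal{B}\to\mathcal{Z}$ be a continuous bilinear mapping, and let $\mathcal{K}$ be a countable index set. Let $\{e_j\}_{j\in\mathcal{K}}$ be an orthonormal basis for $\mathcal{H}$, let $\{x_k\}_{k\in\mathcal{K}}\subset\mathcal{B}$, and let $A,B>0$. (1) $(\{x_k\}_{k\in\mathcal{K}},\mathfrak{b})$ is a b-frame for $\mathcal{Z}$ with b-frame bounds $A$ and $B$ if and only if $\{\mathfrak{b}(e_j,x_k)\}_{j,k\in\mathcal{K}}$ is a frame for $\mathcal{Z}$ with frame bounds $A$ and $B$. (2) Suppose $(\{x_k\}_{k\in\mathcal{K}},\mathfrak{b})$ is a b-frame for $\mathcal{Z}$ (with b-frame bounds $A$ and $B$). Then: (a) An operator $S$ is the b-frame operator of $(\{x_k\}_{k\in\mathcal{K}},\mathfrak{b})$ if and only if $S$ is the frame operator of $\{\mathfrak{b}(e_j,x_k)\}_{j,k\in\mathcal{K}}$. (b) With $S$ the b-frame operator of $(\{x_k\}_{k\in\mathcal{K}},\mathfrak{b})$ and $\tilde{\mathfrak{b}}=S^{-1}\mathfrak{b}$, the system $(\{x_k\}_{k\in\mathcal{K}},\tilde{\mathfrak{b}})$ is a b-frame for $\mathcal{Z}$ with b-frame bounds $B^{-1}$ and $A^{-1}$. (c) For each $z\in\mathcal{Z}$, $$z=\sum_{k\in\mathcal{K}}\tilde{\mathfrak{b}}(\langle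 z/x_k\rangle,x_k)=\sum_{k\in\mathcal{K}}\mathfrak{b}(\langle z/x_k\rangle^{\sim},x_k),$$ where $\langle\cdot/\cdot\rangle$ is the b-frame product with respect to $\mathfrak{b}$ and $\langle\cdot/\cdot\rangle^{\sim}$ is the b-frame product with respect to $\tilde{\mathfrak{b}}$.
   Context: Continuity of a bilinear mapping $\mathfrak{b}:\mathcal{H}\times\mathcal{B}\to\mathcal{Z}$ means there is $M>0$ with $\|\mathfrak{b}(h,x)\|_{\mathcal{Z}}\le M\|h\|_{\mathcal{H}}\|x\|_{\mathcal{B}}$ for all $(h,x)$. For $x\in\mathcal{B}$, $z\in\mathcal{Z}$, the b-frame product $\langle z/x\rangle\in\mathcal{H}$ (with respect to $\mathfrak{b}$) is the unique vector, given by the Riesz representation theorem, such that $\langle\mathfrak{b}(h,x),z\rangle_{\mathcal{Z}}=\langle h,\langle z/x\rangle\rangle_{\mathcal{H}}$ for all $h\in\mathcal{H}$. A system $\{x_k\}_{k\in\mathcal{K}}\subset\mathcal{B}$ (also written $(\{x_k\}_{k\in\mathcal{K}},\mathfrak{b})$) is a b-frame for $\mathcal{Z}$ with b-frame bounds $A,B>0$ if $A\|z\|_{\mathcal{Z}}^2\le\sum_{k\in\mathcal{K}}\|\langle z/x_k\rangle\|_{\mathcal{H}}^2\le B\|z\|_{\mathcal{Z}}^2$ for all $z\in\mathcal{Z}$. Its b-frame operator is $S:\mathcal{Z}\to\mathcal{Z}$, $S(z)=\sum_{k\in\mathcal{K}}\mathfrak{b}(\langle z/x_k\rangle,x_k)$;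 it is positive, self-adjoint, bounded and invertible. The mapping $\tilde{\mathfrak{b}}=S^{-1}\mathfrak{b}$, i.e. $\tilde{\mathfrak{b}}(h,x)=S^{-1}(\mathfrak{b}(h,x))$, is a continuous bilinear mapping $\mathcal{H}\times\mathcal{B}\to\mathcal{Z}$; the system $(\{x_k\}_{k\in\mathcal{K}},\tilde{\mathfrak{b}})$ is called the canonical dual b-frame of $(\{x_k\}_{k\in\mathcal{K}},\mathfrak{b})$. A family $\{f_i\}$ in a Hilbert space $\mathcal{Z}$ is a frame with frame bounds $A,B>0$ if $A\|z\|^2\le\sum_i|\langle z,f_i\rangle|^2\le B\|z\|^2$ for all $z\in\mathcal{Z}$; its frame operator is $z\mapsto\sum_i\langle z,f_i\rangle f_i$. *)

theory Defs
  imports "HOL-Analysis.Analysis"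
begin

(* The scalar field, real or complex. The axioms force every x to be a root of the real
   quadratic (X - x) (X - scalar_cnj x), so up to isomorphism the only models are the reals with
   the identity and the complex numbers with conjugation, each with its usual absolute value. *)
class real_or_complex = real_normed_field +
  fixes scalar_cnj :: "'a \<Rightarrow> 'a"
  assumes scalar_cnj_add: "scalar_cnj (x + y) = scalar_cnj x + scalar_cnj y"
    and scalar_cnj_mult: "scalar_cnj (x * y) = scalar_cnj x * scalar_cnj y"
    and mult_scalar_cnj: "x * scalar_cnj x = (norm x)\<^sup>2 *\<^sub>R 1"

instantiation real :: real_or_complex
begin
definition scalar_cnj_real :: "real \<Rightarrow> real" where "scalar_cnj_real x = x"
instance
  by standard (simp_all add: scalar_cnj_real_def power2_eq_square)
end

instantiation complex :: real_or_complex
begin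
definition scalar_cnj_complex :: "complex \<Rightarrow> complex" where "scalar_cnj_complex = cnj"
instance
  by standard
    (simp_all add: scalar_cnj_complex_def scaleR_conv_of_real flip: complex_norm_square)
end

(* The type class supplies the norm, the topology and the underlying real vector space;
   the parameter supplies the scalar multiplication extending it. *)
locale normed_space_over = vector_space scale
  for scale :: "'k::real_or_complex \<Rightarrow> 'v::real_normed_vector \<Rightarrow> 'v" +
  assumes scale_of_real: "scale (of_real r) v = r *\<^sub>R v"
    and norm_scale: "norm (scale a v) = norm a * norm v"

(* Inner products are linear in the first argument. Completeness comes from class banach. *)
locale hilbert_space_over = normed_space_over scale
  for scale :: "'k::real_or_complex \<Rightarrow> 'v::banach \<Rightarrow> 'v" +
  fixes ip :: "'v \<Rightarrow> 'v \<Rightarrow> 'k"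
  assumes ip_add_left: "ip (u + v) w = ip u w + ip v w"
    and ip_scale_left: "ip (scale a v) w = a * ip v w"
    and ip_commute: "ip v w = scalar_cnj (ip w v)"
    and ip_self: "ip v v = of_real ((norm v)\<^sup>2)"

lemma hilbert_space_over_real:
  "hilbert_space_over (scaleR :: real \<Rightarrow> 'v \<Rightarrow> 'v::{real_inner,banach}) inner"
  by unfold_locales
    (simp_all add: algebra_simps scalar_cnj_real_def inner_commute power2_norm_eq_inner)

lemma hilbert_space_over_complex:
  "hilbert_space_over ((*) :: complex \<Rightarrow> complex \<Rightarrow> complex) (\<lambda>z w. z * cnj w)"
  by unfold_locales
    (simp_all add: algebra_simps scalar_cnj_complex_def scaleR_conv_of_real norm_mult
      flip: complex_norm_square)

definition orthonormal_basis ::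
  "('k::real_or_complex \<Rightarrow> 'v::banach \<Rightarrow> 'v) \<Rightarrow> ('v \<Rightarrow> 'v \<Rightarrow> 'k) \<Rightarrow> 'i set \<Rightarrow> ('i \<Rightarrow> 'v) \<Rightarrow> bool" where
  "orthonormal_basis s ip K e \<longleftrightarrow>
     (\<forall>i\<in>K. \<forall>j\<in>K. ip (e i) (e j) = (if i = j then 1 else 0)) \<and>
     closure (module.span s (e ` K)) = UNIV"

definition continuous_bilinear ::
  "('k::real_or_complex \<Rightarrow> 'h::real_normed_vector \<Rightarrow> 'h) \<Rightarrow>
   ('k \<Rightarrow> 'b::real_normed_vector \<Rightarrow> 'b) \<Rightarrow>
   ('k \<Rightarrow> 'z::real_normed_vector \<Rightarrow> 'z) \<Rightarrow> ('h \<Rightarrow> 'b \<Rightarrow> 'z) \<Rightarrow> bool" where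
  "continuous_bilinear sH sB sZ b \<longleftrightarrow>
     (\<forall>x. Vector_Spaces.linear sH sZ (\<lambda>h. b h x)) \<and>
     (\<forall>h. Vector_Spaces.linear sB sZ (\<lambda>x. b h x)) \<and>
     (\<exists>M>0. \<forall>h x. norm (b h x) \<le> M * norm h * norm x)"

definition bframe_product ::
  "('h \<Rightarrow> 'h \<Rightarrow> 'k) \<Rightarrow> ('z \<Rightarrow> 'z \<Rightarrow> 'k) \<Rightarrow> ('h \<Rightarrow> 'b \<Rightarrow> 'z) \<Rightarrow> 'z \<Rightarrow> 'b \<Rightarrow> 'h" where
  "bframe_product ipH ipZ b z x = (THE v. \<forall>h. ipZ (b h x) z = ipH h v)"

(* Summability is demanded separately because infsum is 0 on families that are not summable. *)
definition bframe ::
  "('k::real_or_complex \<Rightarrow> 'h::banach \<Rightarrow> 'h) \<Rightarrow> ('k \<Rightarrow> 'b::banach \<Rightarrow> 'b) \<Rightarrow>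
   ('k \<Rightarrow> 'z::banach \<Rightarrow> 'z) \<Rightarrow> ('h \<Rightarrow> 'h \<Rightarrow> 'k) \<Rightarrow> ('z \<Rightarrow> 'z \<Rightarrow> 'k) \<Rightarrow>
   'i set \<Rightarrow> ('i \<Rightarrow> 'b) \<Rightarrow> ('h \<Rightarrow> 'b \<Rightarrow> 'z) \<Rightarrow> real \<Rightarrow> real \<Rightarrow> bool" where
  "bframe sH sB sZ ipH ipZ K x b A B \<longleftrightarrow>
     continuous_bilinear sH sB sZ b \<and> 0 < A \<and> 0 < B \<and>
     (\<forall>z. (\<lambda>k. (norm (bframe_product ipH ipZ b z (x k)))\<^sup>2) summable_on K \<and>
          A * (norm z)\<^sup>2 \<le> (\<Sum>\<^sub>\<infinity>k\<in>K. (norm (bframe_product ipH ipZ b z (x k)))\<^sup>2) \<and>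
          (\<Sum>\<^sub>\<infinity>k\<in>K. (norm (bframe_product ipH ipZ b z (x k)))\<^sup>2) \<le> B * (norm z)\<^sup>2)"

definition frame ::
  "('z::banach \<Rightarrow> 'z \<Rightarrow> 'k::real_or_complex) \<Rightarrow> 'j set \<Rightarrow> ('j \<Rightarrow> 'z) \<Rightarrow> real \<Rightarrow> real \<Rightarrow> bool" where
  "frame ip I f A B \<longleftrightarrow> 0 < A \<and> 0 < B \<and>
     (\<forall>z. (\<lambda>i. (norm (ip z (f i)))\<^sup>2) summable_on I \<and>
          A * (norm z)\<^sup>2 \<le> (\<Sum>\<^sub>\<infinity>i\<in>I. (norm (ip z (f i)))\<^sup>2) \<and>
          (\<Sum>\<^sub>\<infinity>i\<in>I. (norm (ip z (f i)))\<^sup>2) \<le> B * (norm z)\<^sup>2)"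

(* The defining series of both operators are required to converge unconditionally in norm. *)
definition is_bframe_operator ::
  "('h \<Rightarrow> 'h \<Rightarrow> 'k) \<Rightarrow> ('z \<Rightarrow> 'z \<Rightarrow> 'k) \<Rightarrow> 'i set \<Rightarrow> ('i \<Rightarrow> 'b) \<Rightarrow> ('h \<Rightarrow> 'b \<Rightarrow> 'z::banach) \<Rightarrow>
   ('z \<Rightarrow> 'z) \<Rightarrow> bool" where
  "is_bframe_operator ipH ipZ K x b S \<longleftrightarrow>
     (\<forall>z. ((\<lambda>k. b (bframe_product ipH ipZ b z (x k)) (x k)) has_sum S z) K)"

definition is_frame_operator ::
  "('k \<Rightarrow> 'z \<Rightarrow> 'z) \<Rightarrow> ('z \<Rightarrow> 'z \<Rightarrow> 'k) \<Rightarrow> 'j set \<Rightarrow> ('j \<Rightarrow> 'z::banach) \<Rightarrow> ('z \<Rightarrow> 'z) \<Rightarrow> bool" where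
  "is_frame_operator s ip I f S \<longleftrightarrow>
     (\<forall>z. ((\<lambda>i. s (ip z (f i)) (f i)) has_sum S z) I)"

definition bframe_operator ::
  "('h \<Rightarrow> 'h \<Rightarrow> 'k) \<Rightarrow> ('z \<Rightarrow> 'z \<Rightarrow> 'k) \<Rightarrow> 'i set \<Rightarrow> ('i \<Rightarrow> 'b) \<Rightarrow> ('h \<Rightarrow> 'b \<Rightarrow> 'z::banach) \<Rightarrow>
   'z \<Rightarrow> 'z" where
  "bframe_operator ipH ipZ K x b = (THE S. is_bframe_operator ipH ipZ K x b S)"

definition canonical_dual_map ::
  "('h \<Rightarrow> 'h \<Rightarrow> 'k) \<Rightarrow> ('z \<Rightarrow> 'z \<Rightarrow> 'k) \<Rightarrow> 'i set \<Rightarrow> ('i \<Rightarrow> 'b) \<Rightarrow> ('h \<Rightarrow> 'b \<Rightarrow> 'z::banach) \<Rightarrow>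
   'h \<Rightarrow> 'b \<Rightarrow> 'z" where
  "canonical_dual_map ipH ipZ K x b h y = inv (bframe_operator ipH ipZ K x b) (b h y)"

end

theory Submission
  imports Defs
begin

text \<open>Expanding in the orthonormal basis gives \<open>\<langle>z, b (e j) y\<rangle> = \<langle>\<langle>z/y\<rangle>, e j\<rangle>\<close>. By Parseval
  the squared moduli sum over \<open>j\<close> to the squared norm of \<open>\<langle>z/y\<rangle>\<close>, and the vectors \<open>\<langle>z, b (e j) y\<rangle> b (e j) y\<close> sum to
  \<open>b \<langle>z/y\<rangle> y\<close>, so both claims relating the b-frame to the frame reduce to interchanging double
  sums. The frame operator \<open>S\<close> is self-adjoint and invertible, whence the b-frame product of the
  dual map is \<open>\<langle>S\<inverse>z/y\<rangle>\<close>; the dual bounds then follow from \<open>A \<parallel>y\<parallel>\<^sup>2 \<le> \<langle>S y, y\<rangle>\<close> and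
  \<open>\<parallel>S y\<parallel>\<^sup>2 \<le> B \<langle>S y, y\<rangle>\<close> at \<open>y = S\<inverse>z\<close>.\<close>

section \<open>Convergence along finite subsets from quadratic estimates\<close>

text \<open>Outside a finite set carrying almost all of the mass of \<open>a\<close>, every finite
  block of \<open>g\<close> has small norm, so the finite partial sums form a Cauchy net and
  completeness applies.\<close>

lemma summable_on_norm_sq_sum_le:
  fixes g :: "'i \<Rightarrow> 'v::banach" and a :: "'i \<Rightarrow> real"
  assumes a: "a summable_on I" and a0: "\<And>i. i \<in> I \<Longrightarrow> 0 \<le> a i" and C: "0 \<le> C"
    and le: "\<And>F. finite F \<Longrightarrow> F \<subseteq> I \<Longrightarrow> (norm (sum g F))\<^sup>2 \<le> C * sum a F"
  shows "g summable_on I"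
proof -
  obtain L where L: "(a has_sum L) I"
    using a by (auto simp: summable_on_def)
  have "\<exists>P. eventually P (finite_subsets_at_top I) \<and>
            (\<forall>F F'. P F \<and> P F' \<longrightarrow> dist (sum g F) (sum g F') < \<epsilon>)" if "\<epsilon> > 0" for \<epsilon>
  proof -
    \<comment> \<open>The denominator \<open>C + 1\<close> also covers \<open>C = 0\<close>. Two
      distances of at most a third of the tolerance then add up to strictly less than all of
      it.\<close>
    define d where "d = (\<epsilon> / 3)\<^sup>2 / (C + 1)"
    have d: "d > 0" "C * d \<le> (\<epsilon> / 3)\<^sup>2"
      using C that by (auto simp: d_def field_simps)
    obtain G where G: "finite G" "G \<subseteq> I" "dist (sum a G) L \<le> d"
      using has_sum_finite_approximation[OF L d(1)] by blast
    have near: "norm (sum g F - sum g G) \<le> \<epsilon> / 3" if "finite F" "G \<subseteq> F" "F \<subseteq> I" for F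
    proof -
      have "sum a F \<le> L"
        using L that a0 by (intro finite_sum_le_has_sum) auto
      then have "sum a (F - G) \<le> d"
        using G that by (simp add: sum_diff dist_real_def)
      then have "C * sum a (F - G) \<le> C * d"
        using C by (rule mult_left_mono)
      then have "(norm (sum g (F - G)))\<^sup>2 \<le> (\<epsilon> / 3)\<^sup>2"
        using le[of "F - G"] that d(2) by force
      then show ?thesis
        using G that \<open>\<epsilon> > 0\<close> by (simp add: sum_diff power2_le_iff_abs_le)
    qed
    show ?thesis
    proof (intro exI conjI allI impI)
      show "\<forall>\<^sub>F F in finite_subsets_at_top I. finite F \<and> G \<subseteq> F \<and> F \<subseteq> I"
        using G by (auto simp: eventually_finite_subsets_at_top)
      fix F F' assume "(finite F \<and> G \<subseteq> F \<and> F \<subseteq> I) \<and> finite F' \<and> G \<subseteq> F' \<and> F' \<subseteq> I"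
      then have "norm (sum g F - sum g G) \<le> \<epsilon> / 3" "norm (sum g F' - sum g G) \<le> \<epsilon> / 3"
        using near by auto
      then show "dist (sum g F) (sum g F') < \<epsilon>"
        using that dist_triangle2[of "sum g F" "sum g F'" "sum g G"] by (simp add: dist_norm)
    qed
  qed
  then have "cauchy_filter (filtermap (sum g) (finite_subsets_at_top I))"
    by (simp add: cauchy_filter_metric_filtermap)
  moreover have "complete (UNIV :: 'v set)"
    by (rule complete_UNIV)
  ultimately obtain s where "(sum g \<longlongrightarrow> s) (finite_subsets_at_top I)"
    using complete_uniform[where S = "UNIV :: 'v set"] by (force simp add: filterlim_def)
  then show ?thesis
    by (auto simp: summable_on_def has_sum_def)
qed

lemma norm_sq_has_sum_le:
  fixes g :: "'i \<Rightarrow> 'v::real_normed_vector" and a :: "'i \<Rightarrow> real"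
  assumes "(g has_sum s) I" and "(a has_sum L) I"
    and "\<And>F. finite F \<Longrightarrow> F \<subseteq> I \<Longrightarrow> (norm (sum g F))\<^sup>2 \<le> C * sum a F"
  shows "(norm s)\<^sup>2 \<le> C * L"
proof (rule tendsto_le)
  show "((\<lambda>F. C * sum a F) \<longlongrightarrow> C * L) (finite_subsets_at_top I)"
    using assms(2) by (intro tendsto_intros) (simp add: has_sum_def)
  show "((\<lambda>F. (norm (sum g F))\<^sup>2) \<longlongrightarrow> (norm s)\<^sup>2) (finite_subsets_at_top I)"
    using assms(1) by (intro tendsto_intros) (simp add: has_sum_def)
  show "\<forall>\<^sub>F F in finite_subsets_at_top I. (norm (sum g F))\<^sup>2 \<le> C * sum a F"
    using assms(3) by (intro eventually_finite_subsets_at_top_weakI) auto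
qed simp

section \<open>Scalar conjugation and inner product algebra\<close>

lemma scalar_cnj_0 [simp]: "scalar_cnj (0 :: 'k::real_or_complex) = 0"
  using scalar_cnj_add[of "0::'k" 0] by simp

text \<open>The axiom \<open>mult_scalar_cnj\<close> determines the conjugate away from 0; isometry,
  involution and fixing of reals all follow from this formula, with no case split into real and
  complex scalars.\<close>

lemma scalar_cnj_eq: "x \<noteq> 0 \<Longrightarrow> scalar_cnj (x :: 'k::real_or_complex) = of_real ((norm x)\<^sup>2) / x"
  using mult_scalar_cnj[of x] by (simp add: field_simps of_real_def)

lemma norm_scalar_cnj [simp]: "norm (scalar_cnj (x :: 'k::real_or_complex)) = norm x"
  by (cases "x = 0") (simp_all add: scalar_cnj_eq norm_divide norm_mult power2_eq_square)

lemma scalar_cnj_of_real [simp]: "scalar_cnj (of_real r :: 'k::real_or_complex) = of_real r"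
  by (cases "r = 0") (simp_all add: scalar_cnj_eq power2_eq_square)

lemma scalar_cnj_cnj [simp]: "scalar_cnj (scalar_cnj (x :: 'k::real_or_complex)) = x"
proof (cases "x = 0")
  case False
  then have "scalar_cnj x \<noteq> 0"
    using norm_scalar_cnj[of x] by force
  then show ?thesis
    using False by (simp add: scalar_cnj_eq norm_divide norm_mult power2_eq_square)
qed simp

context hilbert_space_over
begin

lemma ip_add_right: "ip w (u + v) = ip w u + ip w v"
  by (metis ip_add_left ip_commute scalar_cnj_add)

lemma ip_scale_right: "ip v (scale a w) = scalar_cnj a * ip v w"
  by (metis ip_scale_left ip_commute scalar_cnj_mult)

lemma ip_zero_left [simp]: "ip 0 v = 0"
  using ip_add_left[of 0 0 v] by simp

lemma ip_zero_right [simp]: "ip v 0 = 0"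
  using ip_add_right[of v 0 0] by simp

lemma ip_diff_left: "ip (u - v) w = ip u w - ip v w"
  using ip_add_left[of "u - v" v w] by (simp add: algebra_simps)

lemma ip_diff_right: "ip w (u - v) = ip w u - ip w v"
  using ip_add_right[of w "u - v" v] by (simp add: algebra_simps)

lemma ip_scaleR_left: "ip (r *\<^sub>R v) w = of_real r * ip v w"
  by (metis ip_scale_left scale_of_real)

lemma ip_scaleR_right: "ip v (r *\<^sub>R w) = of_real r * ip v w"
  by (metis ip_scale_right scale_of_real scalar_cnj_of_real)

lemma ip_sum_left: "ip (sum f F) w = (\<Sum>i\<in>F. ip (f i) w)"
  by (induction F rule: infinite_finite_induct) (simp_all add: ip_add_left)

lemma norm_ip_commute: "norm (ip v w) = norm (ip w v)"
  by (metis ip_commute norm_scalar_cnj)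

text \<open>Testing with \<open>w = u - v\<close> forces the norm of the difference to
  vanish.\<close>

lemma ip_eqI: "(\<And>w. ip w u = ip w v) \<Longrightarrow> u = v"
  using ip_self[of "u - v"] by (simp add: ip_diff_right)

lemma ip_mult_commute: "ip v w * ip w v = of_real ((norm (ip v w))\<^sup>2)"
  by (metis ip_commute mult_scalar_cnj of_real_def)

lemma norm_ip_le: "norm (ip v w) \<le> norm v * norm w"
proof (cases "w = 0")
  case False
  \<comment> \<open>This is \<open>ip w w\<close> times the component of \<open>v\<close> orthogonal
    to \<open>w\<close>; clearing the denominator avoids division in the scalar field.\<close>
  define u where "u = scale (ip w w) v - scale (ip v w) w"
  define r :: real where "r = (norm w)\<^sup>2 * ((norm w)\<^sup>2 * (norm v)\<^sup>2 - (norm (ip v w))\<^sup>2)"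
  have "of_real ((norm u)\<^sup>2) = ip u u"
    by (simp only: ip_self)
  also have "\<dots> = ip w w * (ip w w * ip v v - ip v w * ip w v)"
    by (simp add: u_def ip_diff_left ip_diff_right ip_scale_left ip_scale_right algebra_simps
          flip: ip_commute[of w v] ip_commute[of w w])
  also have "\<dots> = of_real r"
    by (simp add: r_def ip_mult_commute ip_self)
  finally have "r = (norm u)\<^sup>2"
    by (simp only: of_real_eq_iff)
  then have "0 \<le> (norm w)\<^sup>2 * ((norm w)\<^sup>2 * (norm v)\<^sup>2 - (norm (ip v w))\<^sup>2)"
    unfolding r_def by simp
  then have "(norm (ip v w))\<^sup>2 \<le> (norm v * norm w)\<^sup>2"
    using False by (simp add: zero_le_mult_iff power_mult_distrib mult.commute)
  then show ?thesis
    by (rule power2_le_imp_le) simp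
qed simp

lemma bounded_linear_ip_left: "bounded_linear (\<lambda>v. ip v w)"
  by (rule bounded_linear_intro[where K = "norm w"])
    (simp_all add: ip_add_left ip_scaleR_left scaleR_conv_of_real norm_ip_le)

lemma bounded_linear_ip_right: "bounded_linear (ip w)"
  by (rule bounded_linear_intro[where K = "norm w"])
    (simp_all add: ip_add_right ip_scaleR_right scaleR_conv_of_real norm_ip_le mult.commute[of _ "norm w"])

section \<open>Bessel families and orthonormal bases\<close>

text \<open>Quantifying over finite subsets keeps the condition independent of summability, which
  \<open>bessel_summable_coeff\<close> then derives from it.\<close>

definition bessel :: "'i set \<Rightarrow> ('i \<Rightarrow> 'v) \<Rightarrow> real \<Rightarrow> bool" where
  "bessel I f B \<longleftrightarrow> 0 \<le> B \<and>
     (\<forall>w F. finite F \<longrightarrow> F \<subseteq> I \<longrightarrow> (\<Sum>i\<in>F. (norm (ip w (f i)))\<^sup>2) \<le> B * (norm w)\<^sup>2)"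

text \<open>This bounds the synthesis map by duality: pair the sum \<open>u\<close> with itself,
  apply Cauchy-Schwarz to the finite sum and the Bessel bound to \<open>u\<close>, then cancel one
  factor \<open>norm u\<close> squared, which is why \<open>u = 0\<close> is treated apart.\<close>

lemma bessel_norm_sum_le:
  assumes "bessel I f B" and F: "finite F" "F \<subseteq> I"
  shows "(norm (\<Sum>i\<in>F. scale (c i) (f i)))\<^sup>2 \<le> B * (\<Sum>i\<in>F. (norm (c i))\<^sup>2)"
proof (cases "(\<Sum>i\<in>F. scale (c i) (f i)) = 0")
  case True
  then show ?thesis
    using assms by (simp add: bessel_def sum_nonneg)
next
  case False
  define u where "u = (\<Sum>i\<in>F. scale (c i) (f i))"
  define q where "q = (\<Sum>i\<in>F. (norm (c i))\<^sup>2)"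
  have "of_real ((norm u)\<^sup>2) = (\<Sum>i\<in>F. c i * ip (f i) u)"
    unfolding u_def ip_self[symmetric] by (subst ip_sum_left) (simp add: ip_scale_left)
  then have "norm (of_real ((norm u)\<^sup>2) :: 'k) \<le> (\<Sum>i\<in>F. norm (c i) * norm (ip u (f i)))"
    by (metis (no_types, lifting) norm_ip_commute norm_mult norm_sum sum.cong)
  then have "((norm u)\<^sup>2)\<^sup>2 \<le> (\<Sum>i\<in>F. norm (c i) * norm (ip u (f i)))\<^sup>2"
    by (intro power_mono) (auto simp: norm_power)
  also have "\<dots> \<le> q * (\<Sum>i\<in>F. (norm (ip u (f i)))\<^sup>2)"
    unfolding q_def by (rule Cauchy_Schwarz_ineq_sum)
  also have "\<dots> \<le> q * (B * (norm u)\<^sup>2)"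
    using assms by (intro mult_left_mono) (auto simp: bessel_def q_def sum_nonneg)
  finally have "(norm u)\<^sup>2 * (norm u)\<^sup>2 \<le> (norm u)\<^sup>2 * (B * q)"
    by (simp add: power2_eq_square mult_ac)
  moreover have "0 < (norm u)\<^sup>2"
    using False by (simp add: u_def)
  ultimately have "(norm u)\<^sup>2 \<le> B * q"
    by (simp only: mult_le_cancel_left_pos)
  then show ?thesis
    by (simp only: u_def q_def)
qed

lemma bessel_summable:
  assumes "bessel I f B" and "(\<lambda>i. (norm (c i))\<^sup>2) summable_on I"
  shows "(\<lambda>i. scale (c i) (f i)) summable_on I"
  using assms bessel_norm_sum_le[OF assms(1)]
  by (intro summable_on_norm_sq_sum_le[OF assms(2), of B]) (auto simp: bessel_def)

lemma bessel_summable_coeff: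
  assumes "bessel I f B"
  shows "(\<lambda>i. (norm (ip w (f i)))\<^sup>2) summable_on I"
  using assms by (intro nonneg_bdd_above_summable_on) (auto simp: bessel_def bdd_above_def)

lemma summable_bessel_expansion:
  "bessel I f B \<Longrightarrow> (\<lambda>i. scale (ip w (f i)) (f i)) summable_on I"
  by (rule bessel_summable[OF _ bessel_summable_coeff])

text \<open>With \<open>u\<close> the projection of \<open>w\<close> onto the span of finitely many
  basis vectors, \<open>ip u u\<close>, \<open>ip u w\<close> and \<open>ip w u\<close> all equal
  \<open>q\<close>, so the squared norm of \<open>w - u\<close> is that of \<open>w\<close> minus
  \<open>q\<close>.\<close>

lemma orthonormal_basis_bessel:
  assumes "orthonormal_basis scale ip K e"
  shows "bessel K e 1"
  unfolding bessel_def
proof (intro conjI allI impI)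
  fix w F assume F: "finite F" "F \<subseteq> K"
  define c where "c i = ip w (e i)" for i
  define u where "u = (\<Sum>i\<in>F. scale (c i) (e i))"
  define q where "q = (\<Sum>i\<in>F. (norm (c i))\<^sup>2)"
  have "ip (e i) (e j) = (if i = j then 1 else 0)" if "i \<in> F" "j \<in> F" for i j
    using assms F that unfolding orthonormal_basis_def by (meson subsetD)
  then have "ip u (e j) = c j" if "j \<in> F" for j
    using F that by (simp add: u_def ip_sum_left ip_scale_left if_distrib[of "\<lambda>x. _ * x"] cong: if_cong)
  then have "ip (e j) u = scalar_cnj (c j)" if "j \<in> F" for j
    using that ip_commute by metis
  then have "ip u u = (\<Sum>i\<in>F. c i * scalar_cnj (c i))"
    by (subst (1) u_def) (simp add: ip_sum_left ip_scale_left)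
  also have "\<dots> = of_real q"
    by (simp add: q_def mult_scalar_cnj of_real_def scaleR_left.sum)
  finally have uu: "ip u u = of_real q" .
  have "ip u w = (\<Sum>i\<in>F. c i * ip (e i) w)"
    by (simp add: u_def ip_sum_left ip_scale_left)
  also have "\<dots> = (\<Sum>i\<in>F. c i * scalar_cnj (c i))"
    by (simp add: c_def flip: ip_commute)
  also have "\<dots> = of_real q"
    by (simp add: q_def mult_scalar_cnj of_real_def scaleR_left.sum)
  finally have uw: "ip u w = of_real q" .
  then have wu: "ip w u = of_real q"
    using ip_commute[of w u] by simp
  have "of_real ((norm (w - u))\<^sup>2) = (of_real ((norm w)\<^sup>2 - q) :: 'k)"
    unfolding ip_self[symmetric] of_real_diff
    by (simp add: ip_diff_left ip_diff_right uu uw wu)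
  then have "(norm (w - u))\<^sup>2 = (norm w)\<^sup>2 - q"
    by (simp only: of_real_eq_iff)
  then show "(\<Sum>i\<in>F. (norm (ip w (e i)))\<^sup>2) \<le> 1 * (norm w)\<^sup>2"
    using zero_le_power2[of "norm (w - u)"] by (simp add: q_def c_def)
qed simp

lemma orthonormal_basis_ip_has_sum:
  assumes "orthonormal_basis scale ip K e" and "i \<in> K"
    and "((\<lambda>j. scale (c j) (e j)) has_sum v) K"
  shows "ip v (e i) = c i"
proof -
  have "((\<lambda>j. ip (scale (c j) (e j)) (e i)) has_sum ip v (e i)) K"
    using bounded_linear_ip_left assms(3) by (rule has_sum_bounded_linear)
  moreover have "((\<lambda>j. ip (scale (c j) (e j)) (e i)) has_sum c i) K"
    using assms(1,2) by (intro has_sum_finite_neutralI[where B = "{i}"])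
      (auto simp: ip_scale_left orthonormal_basis_def)
  ultimately show ?thesis
    by (rule has_sum_unique)
qed

text \<open>The vectors orthogonal to \<open>v\<close> form a closed set containing the dense span,
  hence contain \<open>v\<close> itself.\<close>

lemma orthonormal_basis_orthogonal_imp_zero:
  assumes "orthonormal_basis scale ip K e" and "\<And>i. i \<in> K \<Longrightarrow> ip v (e i) = 0"
  shows "v = 0"
proof -
  have "span (e ` K) \<subseteq> {w. ip v w = 0}"
  proof
    fix w assume "w \<in> span (e ` K)"
    then show "w \<in> {w. ip v w = 0}"
      by (induction rule: span_induct_alt) (use assms(2) in \<open>auto simp: ip_add_right ip_scale_right\<close>)
  qed
  moreover have "closed {w. ip v w = 0}"
    by (intro closed_Collect_eq continuous_intros
        linear_continuous_on[OF bounded_linear_ip_right])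
  ultimately have "closure (span (e ` K)) \<subseteq> {w. ip v w = 0}"
    by (rule closure_minimal)
  then have "ip v v = 0"
    using assms(1) by (auto simp: orthonormal_basis_def)
  then show ?thesis
    by (simp add: ip_self)
qed

text \<open>The Bessel property makes the series converge to some \<open>u\<close>; comparing
  coefficients, \<open>v - u\<close> is orthogonal to the whole basis.\<close>

lemma orthonormal_basis_expansion:
  assumes "orthonormal_basis scale ip K e"
  shows "((\<lambda>j. scale (ip v (e j)) (e j)) has_sum v) K"
proof -
  obtain u where u: "((\<lambda>j. scale (ip v (e j)) (e j)) has_sum u) K"
    using summable_bessel_expansion[OF orthonormal_basis_bessel[OF assms]]
    by (auto simp: summable_on_def)
  have "v - u = 0"
    using orthonormal_basis_ip_has_sum[OF assms _ u]
    by (intro orthonormal_basis_orthogonal_imp_zero[OF assms]) (simp add: ip_diff_left)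
  with u show ?thesis
    by simp
qed

text \<open>The summands are squared moduli embedded in the scalar field. This serves both
  Parseval's identity and the quadratic form of the frame operator.\<close>

lemma has_sum_ip_mult_commute:
  assumes "bessel I f B" and "((\<lambda>i. ip v (f i) * ip (f i) v) has_sum s) I"
  shows "s = of_real (\<Sum>\<^sub>\<infinity>i\<in>I. (norm (ip v (f i)))\<^sup>2)"
proof (rule has_sum_unique)
  show "((\<lambda>i. of_real ((norm (ip v (f i)))\<^sup>2)) has_sum s) I"
    using assms(2) by (simp only: ip_mult_commute)
  show "((\<lambda>i. of_real ((norm (ip v (f i)))\<^sup>2) :: 'k) has_sum
      of_real (\<Sum>\<^sub>\<infinity>i\<in>I. (norm (ip v (f i)))\<^sup>2)) I"
    using bounded_linear_of_real has_sum_infsum[OF bessel_summable_coeff[OF assms(1)]]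
    by (rule has_sum_bounded_linear)
qed

lemma parseval:
  assumes "orthonormal_basis scale ip K e"
  shows "((\<lambda>j. (norm (ip v (e j)))\<^sup>2) has_sum (norm v)\<^sup>2) K"
proof -
  have bess: "bessel K e 1"
    using assms by (rule orthonormal_basis_bessel)
  have "((\<lambda>j. ip (scale (ip v (e j)) (e j)) v) has_sum ip v v) K"
    using bounded_linear_ip_left orthonormal_basis_expansion[OF assms]
    by (rule has_sum_bounded_linear)
  then have "ip v v = of_real (\<Sum>\<^sub>\<infinity>j\<in>K. (norm (ip v (e j)))\<^sup>2)"
    using bess by (intro has_sum_ip_mult_commute) (simp_all add: ip_scale_left)
  then have "(norm v)\<^sup>2 = (\<Sum>\<^sub>\<infinity>j\<in>K. (norm (ip v (e j)))\<^sup>2)"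
    by (simp only: ip_self of_real_eq_iff)
  with bessel_summable_coeff[OF bess] show ?thesis
    by (simp only: has_sum_infsum)
qed

text \<open>With an orthonormal basis at hand, the representing vector is the series
  \<open>\<Sum>j. scalar_cnj (\<phi> (e j)) e j\<close>, so no projection theorem is needed.\<close>

lemma riesz_representation:
  assumes onb: "orthonormal_basis scale ip K e"
    and lin: "Vector_Spaces.linear scale (*) \<phi>"
    and C: "\<And>v. norm (\<phi> v) \<le> C * norm v"
  shows "\<exists>!v. \<forall>h. \<phi> h = ip h v"
proof -
  interpret \<phi>: Vector_Spaces.linear scale "(*)" \<phi>
    by (rule lin)
  have "bounded_linear \<phi>"
  proof (rule bounded_linear_intro[where K = C])
    show "\<phi> (r *\<^sub>R u) = r *\<^sub>R \<phi> u" for r u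
      by (metis \<phi>.scale scale_of_real scaleR_conv_of_real)
  qed (simp_all add: \<phi>.add C mult.commute[of _ C])
  have bess: "bessel K e 1"
    using onb by (rule orthonormal_basis_bessel)
  define c where "c j = scalar_cnj (\<phi> (e j))" for j
  have "(\<Sum>j\<in>F. (norm (c j))\<^sup>2) \<le> C\<^sup>2" if F: "finite F" "F \<subseteq> K" for F
  proof -
    define s where "s = (\<Sum>j\<in>F. (norm (c j))\<^sup>2)"
    \<comment> \<open>Testing the functional on the truncated candidate gives the value
      \<open>s\<close>, while the Bessel bound controls \<open>norm h\<close> by the root of
      \<open>s\<close>; hence \<open>s\<close> is at most the square of \<open>C\<close>, uniformly
      in \<open>F\<close>.\<close>
    define h where "h = (\<Sum>j\<in>F. scale (c j) (e j))"
    have "s \<ge> 0"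
      by (simp add: s_def sum_nonneg)
    have "\<phi> h = (\<Sum>j\<in>F. c j * \<phi> (e j))"
      by (simp add: h_def \<phi>.sum \<phi>.scale)
    also have "\<dots> = (\<Sum>j\<in>F. c j * scalar_cnj (c j))"
      by (simp add: c_def)
    also have "\<dots> = of_real s"
      by (simp add: s_def mult_scalar_cnj of_real_def scaleR_left.sum)
    finally have "s \<le> C * norm h"
      using C[of h] \<open>s \<ge> 0\<close> by simp
    then have "s\<^sup>2 \<le> (C * norm h)\<^sup>2"
      using \<open>s \<ge> 0\<close> by (rule power_mono)
    also have "\<dots> \<le> C\<^sup>2 * s"
      using bessel_norm_sum_le[OF bess F, of c]
      by (simp add: power_mult_distrib mult_left_mono h_def s_def)
    finally have "s \<le> C\<^sup>2"
      using \<open>s \<ge> 0\<close> by (cases "s = 0") (simp_all add: power2_eq_square)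
    then show ?thesis
      by (simp only: s_def)
  qed
  then have "(\<lambda>j. (norm (c j))\<^sup>2) summable_on K"
    by (intro nonneg_bdd_above_summable_on) (auto simp: bdd_above_def)
  then obtain v where v: "((\<lambda>j. scale (c j) (e j)) has_sum v) K"
    using bessel_summable[OF bess] by (auto simp: summable_on_def)
  have "\<phi> h = ip h v" for h
  proof -
    have "((\<lambda>j. \<phi> (scale (ip h (e j)) (e j))) has_sum \<phi> h) K"
      using \<open>bounded_linear \<phi>\<close> orthonormal_basis_expansion[OF onb]
      by (rule has_sum_bounded_linear)
    moreover have "((\<lambda>j. ip h (scale (c j) (e j))) has_sum ip h v) K"
      using bounded_linear_ip_right v by (rule has_sum_bounded_linear)
    ultimately show ?thesis
      by (simp add: \<phi>.scale ip_scale_right c_def mult.commute has_sum_unique)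
  qed
  then show ?thesis
    by (metis ip_eqI)
qed

end

section \<open>Frames, the frame operator and its inverse\<close>

locale hilbert_frame = hilbert_space_over scale ip
  for scale :: "'k::real_or_complex \<Rightarrow> 'v::banach \<Rightarrow> 'v" and ip :: "'v \<Rightarrow> 'v \<Rightarrow> 'k" +
  fixes I :: "'i set" and f :: "'i \<Rightarrow> 'v" and A B :: real
  assumes frame: "frame ip I f A B"
begin

abbreviation sqsum :: "'v \<Rightarrow> real" where
  "sqsum z \<equiv> (\<Sum>\<^sub>\<infinity>i\<in>I. (norm (ip z (f i)))\<^sup>2)"

lemma bounds_pos: "0 < A" "0 < B"
  and sqsum_summable: "(\<lambda>i. (norm (ip z (f i)))\<^sup>2) summable_on I"
  and sqsum_ge: "A * (norm z)\<^sup>2 \<le> sqsum z"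
  and sqsum_le: "sqsum z \<le> B * (norm z)\<^sup>2"
  using frame by (auto simp: frame_def)

lemma frame_bessel: "bessel I f B"
  unfolding bessel_def
proof (intro conjI allI impI)
  fix w F assume "finite F" "F \<subseteq> I"
  then have "(\<Sum>i\<in>F. (norm (ip w (f i)))\<^sup>2) \<le> sqsum w"
    using sqsum_summable by (intro finite_sum_le_infsum) auto
  also have "\<dots> \<le> B * (norm w)\<^sup>2"
    by (rule sqsum_le)
  finally show "(\<Sum>i\<in>F. (norm (ip w (f i)))\<^sup>2) \<le> B * (norm w)\<^sup>2" .
qed (use bounds_pos in simp)

definition frame_op :: "'v \<Rightarrow> 'v" where
  "frame_op z = (\<Sum>\<^sub>\<infinity>i\<in>I. scale (ip z (f i)) (f i))"

lemma has_sum_frame_op: "((\<lambda>i. scale (ip z (f i)) (f i)) has_sum frame_op z) I"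
  unfolding frame_op_def by (rule has_sum_infsum[OF summable_bessel_expansion[OF frame_bessel]])

lemma is_frame_operator_iff: "is_frame_operator scale ip I f S \<longleftrightarrow> S = frame_op"
  using has_sum_frame_op has_sum_unique by (fastforce simp: is_frame_operator_def)

lemma has_sum_ip_frame_op: "((\<lambda>i. ip z (f i) * ip (f i) w) has_sum ip (frame_op z) w) I"
  using has_sum_bounded_linear[OF bounded_linear_ip_left has_sum_frame_op]
  by (simp add: ip_scale_left)

text \<open>Both sides are limits of the same series of products
  \<open>ip z (f i) * ip (f i) w\<close>.\<close>

lemma frame_op_adjoint: "ip (frame_op z) w = ip z (frame_op w)"
proof -
  have "((\<lambda>i. ip z (scale (ip w (f i)) (f i))) has_sum ip z (frame_op w)) I"
    using bounded_linear_ip_right has_sum_frame_op by (rule has_sum_bounded_linear)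
  then have "((\<lambda>i. ip z (f i) * ip (f i) w) has_sum ip z (frame_op w)) I"
    by (simp add: ip_scale_right mult.commute flip: ip_commute)
  with has_sum_ip_frame_op show ?thesis
    by (rule has_sum_unique)
qed

lemma frame_op_diff: "frame_op (u - v) = frame_op u - frame_op v"
  by (rule ip_eqI) (simp add: ip_diff_right flip: frame_op_adjoint)

lemma ip_frame_op_self: "ip (frame_op z) z = of_real (sqsum z)"
  using has_sum_ip_mult_commute[OF frame_bessel has_sum_ip_frame_op] .

text \<open>Keeping \<open>sqsum z\<close> on the right, instead of bounding it by the norm of
  \<open>z\<close>, is what later yields the dual bound \<open>inverse B\<close>.\<close>

lemma norm_frame_op_sq_le: "(norm (frame_op z))\<^sup>2 \<le> B * sqsum z"
  using has_sum_frame_op has_sum_infsum[OF sqsum_summable] bessel_norm_sum_le[OF frame_bessel]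
  by (rule norm_sq_has_sum_le)

lemma sqsum_le_norm_frame_op: "sqsum z \<le> norm (frame_op z) * norm z"
proof -
  have "norm (of_real (sqsum z) :: 'k) \<le> norm (frame_op z) * norm z"
    unfolding ip_frame_op_self[symmetric] by (rule norm_ip_le)
  then show ?thesis
    by simp
qed

text \<open>The lower frame bound makes the quadratic form coercive. Injectivity and the norm bound
  for the inverse come from here.\<close>

lemma norm_frame_op_ge: "A * norm z \<le> norm (frame_op z)"
proof (cases "z = 0")
  case False
  have "norm z * (A * norm z) \<le> norm z * norm (frame_op z)"
    using order_trans[OF sqsum_ge sqsum_le_norm_frame_op] by (simp add: power2_eq_square mult_ac)
  with False show ?thesis
    by simp
qed simp

text \<open>Lax--Milgram: for \<open>t = A / (A\<^sup>2 + B\<^sup>2)\<close> the map \<open>y \<mapsto> y + t (w - S y)\<close> is a contraction, and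
  its fixed point solves \<open>S y = w\<close>.\<close>

lemma surj_frame_op: "surj frame_op"
proof -
  \<comment> \<open>Since \<open>t * (A\<^sup>2 + B\<^sup>2) = A\<close>, the quadratic term of the
    expansion cancels half of the linear one and leaves the factor \<open>c\<close>. The summand
    \<open>A\<^sup>2\<close> ensures \<open>0 \<le> c\<close> without comparing \<open>A\<close> and
    \<open>B\<close>.\<close>
  define t where "t = A / (A\<^sup>2 + B\<^sup>2)"
  define c where "c = 1 - A * t"
  have t: "t > 0"
    using bounds_pos by (simp add: t_def add_pos_pos)
  have "0 \<le> c" "c < 1"
    using bounds_pos t by (auto simp: c_def t_def field_simps power2_eq_square add_pos_pos)
  have contr: "(norm (u - t *\<^sub>R frame_op u))\<^sup>2 \<le> c * (norm u)\<^sup>2" for u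
  proof -
    have "of_real ((norm (u - t *\<^sub>R frame_op u))\<^sup>2)
        = (of_real ((norm u)\<^sup>2 - 2 * t * sqsum u + t\<^sup>2 * (norm (frame_op u))\<^sup>2) :: 'k)"
      unfolding ip_self[symmetric]
      unfolding ip_diff_left ip_diff_right ip_scaleR_left ip_scaleR_right
      by (simp add: ip_self ip_frame_op_self algebra_simps power2_eq_square
          flip: frame_op_adjoint)
    then have "(norm (u - t *\<^sub>R frame_op u))\<^sup>2
        = (norm u)\<^sup>2 - 2 * t * sqsum u + t\<^sup>2 * (norm (frame_op u))\<^sup>2"
      by (simp only: of_real_eq_iff)
    \<comment> \<open>The lower frame bound enters the linear term, and the upper one is used twice
      in the quadratic term.\<close>
    also have "\<dots> \<le> (norm u)\<^sup>2 - 2 * t * (A * (norm u)\<^sup>2) + t\<^sup>2 * (B * (B * (norm u)\<^sup>2))"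
      using t bounds_pos sqsum_ge[of u] sqsum_le[of u] norm_frame_op_sq_le[of u]
      by (intro add_mono diff_mono mult_left_mono order_trans[OF norm_frame_op_sq_le]) auto
    also have "\<dots> \<le> (norm u)\<^sup>2 - 2 * t * (A * (norm u)\<^sup>2) + t * (t * (A\<^sup>2 + B\<^sup>2)) * (norm u)\<^sup>2"
      using t bounds_pos by (simp add: algebra_simps power2_eq_square)
    also have "t * (A\<^sup>2 + B\<^sup>2) = A"
      using bounds_pos by (simp add: t_def add_pos_pos)
    finally show ?thesis
      by (simp add: c_def algebra_simps)
  qed
  show ?thesis
  proof
    show "UNIV \<subseteq> range frame_op"
    proof
      fix w
      define g where "g y = y + t *\<^sub>R (w - frame_op y)" for y
      have "dist (g y) (g y') \<le> sqrt c * dist y y'" for y y'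
      proof -
        have "(dist (g y) (g y'))\<^sup>2 \<le> c * (dist y y')\<^sup>2"
          using contr[of "y - y'"] by (simp add: dist_norm g_def frame_op_diff algebra_simps)
        also have "\<dots> = (sqrt c * dist y y')\<^sup>2"
          using \<open>0 \<le> c\<close> by (simp add: power_mult_distrib)
        finally show ?thesis
          by (rule power2_le_imp_le) (use \<open>0 \<le> c\<close> in simp)
      qed
      then have "\<exists>!y. g y = y"
        using \<open>0 \<le> c\<close> \<open>c < 1\<close> by (intro banach_fix_type[of "sqrt c"]) auto
      then obtain y where "g y = y"
        by blast
      then have "frame_op y = w"
        using t by (simp add: g_def)
      then show "w \<in> range frame_op"
        by blast
    qed
  qed simp
qed

lemma bij_frame_op: "bij frame_op"
proof (rule bijI[OF injI surj_frame_op])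
  fix u v assume "frame_op u = frame_op v"
  then show "u = v"
    using norm_frame_op_ge[of "u - v"] bounds_pos by (simp add: frame_op_diff mult_le_0_iff)
qed

abbreviation inv_op :: "'v \<Rightarrow> 'v" where
  "inv_op \<equiv> inv frame_op"

lemma frame_op_inv [simp]: "frame_op (inv_op z) = z"
  by (rule surj_f_inv_f[OF surj_frame_op])

lemma inv_frame_op [simp]: "inv_op (frame_op z) = z"
  by (rule inv_f_f[OF bij_is_inj[OF bij_frame_op]])

lemma inv_op_adjoint: "ip (inv_op z) w = ip z (inv_op w)"
  using frame_op_adjoint[of "inv_op z" "inv_op w"] by simp

text \<open>Linearity comes from self-adjointness: once \<open>inv_op\<close> is moved to the other
  slot, additivity and homogeneity are those of the inner product.\<close>

lemma linear_inv_op: "Vector_Spaces.linear scale scale inv_op"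
  by unfold_locales
    (rule ip_eqI; simp add: ip_add_right ip_scale_right flip: inv_op_adjoint)+

lemma norm_inv_op_le: "norm (inv_op z) \<le> norm z / A"
  using norm_frame_op_ge[of "inv_op z"] bounds_pos by (simp add: field_simps)

lemma bounded_linear_inv_op: "bounded_linear inv_op"
proof (rule bounded_linear_intro[where K = "inverse A"])
  interpret L: Vector_Spaces.linear scale scale inv_op
    by (rule linear_inv_op)
  show "inv_op (r *\<^sub>R u) = r *\<^sub>R inv_op u" for r u
    by (metis L.scale scale_of_real)
  show "inv_op (u + v) = inv_op u + inv_op v" for u v
    by (rule L.add)
qed (use norm_inv_op_le in \<open>simp add: divide_inverse\<close>)

lemma sqsum_inv_op_ge: "inverse B * (norm z)\<^sup>2 \<le> sqsum (inv_op z)"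
  using norm_frame_op_sq_le[of "inv_op z"] bounds_pos by (simp add: field_simps)

text \<open>Cauchy-Schwarz for the quadratic form at \<open>inv_op z\<close>, followed by the norm
  bound on \<open>inv_op\<close>.\<close>

lemma sqsum_inv_op_le: "sqsum (inv_op z) \<le> inverse A * (norm z)\<^sup>2"
proof -
  have "sqsum (inv_op z) \<le> norm z * norm (inv_op z)"
    using sqsum_le_norm_frame_op[of "inv_op z"] by simp
  also have "\<dots> \<le> norm z * (norm z / A)"
    by (intro mult_left_mono norm_inv_op_le) simp
  finally show ?thesis
    by (simp add: power2_eq_square field_simps)
qed

end

section \<open>Bilinear mappings and the b-frame product\<close>

text \<open>Applied with \<open>T\<close> the inverse frame operator, to see that the dual map is
  again continuous bilinear.\<close>

lemma continuous_bilinear_compose: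
  assumes b: "continuous_bilinear sH sB sZ b"
    and T: "Vector_Spaces.linear sZ sZ' T" "bounded_linear T"
  shows "continuous_bilinear sH sB sZ' (\<lambda>h y. T (b h y))"
proof -
  obtain M where M: "M > 0" "\<And>h x. norm (b h x) \<le> M * norm h * norm x"
    using b by (auto simp: continuous_bilinear_def)
  obtain C where C: "C > 0" "\<And>z. norm (T z) \<le> norm z * C"
    using bounded_linear.pos_bounded[OF T(2)] by blast
  have "norm (T (b h y)) \<le> (M * C) * norm h * norm y" for h y
  proof -
    have "norm (T (b h y)) \<le> norm (b h y) * C"
      by (rule C)
    also have "\<dots> \<le> M * norm h * norm y * C"
      using C(1) M(2) by (intro mult_right_mono) auto
    finally show ?thesis
      by (simp add: mult_ac)
  qed
  moreover have "Vector_Spaces.linear sH sZ' (\<lambda>h. T (b h y))" for y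
    using Vector_Spaces.linear_compose[OF _ T(1), of sH "\<lambda>h. b h y"] b
    by (simp add: continuous_bilinear_def o_def)
  moreover have "Vector_Spaces.linear sB sZ' (\<lambda>y. T (b h y))" for h
    using Vector_Spaces.linear_compose[OF _ T(1), of sB "\<lambda>y. b h y"] b
    by (simp add: continuous_bilinear_def o_def)
  ultimately show ?thesis
    using M(1) C(1) unfolding continuous_bilinear_def
    by (intro conjI allI exI[of _ "M * C"]) auto
qed

locale bframe_setting =
  H: hilbert_space_over sH ipH + Z: hilbert_space_over sZ ipZ
  for sH :: "'k::real_or_complex \<Rightarrow> 'h::banach \<Rightarrow> 'h" and ipH :: "'h \<Rightarrow> 'h \<Rightarrow> 'k"
    and sZ :: "'k \<Rightarrow> 'z::banach \<Rightarrow> 'z" and ipZ :: "'z \<Rightarrow> 'z \<Rightarrow> 'k" +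
  fixes sB :: "'k \<Rightarrow> 'b::banach \<Rightarrow> 'b"
    and b :: "'h \<Rightarrow> 'b \<Rightarrow> 'z" and K :: "'i set" and e :: "'i \<Rightarrow> 'h" and x :: "'i \<Rightarrow> 'b"
  assumes bil: "continuous_bilinear sH sB sZ b"
    and onb: "orthonormal_basis sH ipH K e"
begin

abbreviation prod_b :: "'z \<Rightarrow> 'b \<Rightarrow> 'h" where
  "prod_b \<equiv> bframe_product ipH ipZ b"

abbreviation fam :: "'i \<times> 'i \<Rightarrow> 'z" where
  "fam \<equiv> \<lambda>(j, k). b (e j) (x k)"

lemma linear_b: "Vector_Spaces.linear sH sZ (\<lambda>h. b h y)"
  using bil by (simp add: continuous_bilinear_def)

lemma b_scale: "b (sH a h) y = sZ a (b h y)"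
proof -
  interpret Vector_Spaces.linear sH sZ "\<lambda>h. b h y"
    by (rule linear_b)
  show ?thesis
    by (rule scale)
qed

lemma bounded_linear_b: "bounded_linear (\<lambda>h. b h y)"
proof -
  interpret L: Vector_Spaces.linear sH sZ "\<lambda>h. b h y"
    by (rule linear_b)
  obtain M where M: "\<And>h x. norm (b h x) \<le> M * norm h * norm x"
    using bil by (auto simp: continuous_bilinear_def)
  show ?thesis
  proof (rule bounded_linear_intro[where K = "M * norm y"])
    show "b (r *\<^sub>R h) y = r *\<^sub>R b h y" for r h
      by (metis b_scale H.scale_of_real Z.scale_of_real)
  qed (use M in \<open>simp_all add: L.add mult_ac\<close>)
qed

text \<open>For fixed \<open>y\<close> and \<open>z\<close> the left side is a bounded functional of
  \<open>h\<close>, so Riesz representation gives the unique existence that the \<open>THE\<close>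
  in \<open>bframe_product\<close> relies on.\<close>

lemma bframe_product_spec: "ipZ (b h y) z = ipH h (prod_b z y)"
proof -
  interpret L: Vector_Spaces.linear sH sZ "\<lambda>h. b h y"
    by (rule linear_b)
  obtain M where M: "M > 0" "\<And>h x. norm (b h x) \<le> M * norm h * norm x"
    using bil by (auto simp: continuous_bilinear_def)
  have "Vector_Spaces.linear sH (*) (\<lambda>h. ipZ (b h y) z)"
    by unfold_locales (simp_all add: L.add L.scale Z.ip_add_left Z.ip_scale_left algebra_simps)
  moreover have "norm (ipZ (b h y) z) \<le> M * norm y * norm z * norm h" for h
  proof -
    have "norm (ipZ (b h y) z) \<le> norm (b h y) * norm z"
      by (rule Z.norm_ip_le)
    also have "\<dots> \<le> M * norm h * norm y * norm z"
      by (intro mult_right_mono M) simp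
    finally show ?thesis
      by (simp add: mult_ac)
  qed
  ultimately have "\<exists>!v. \<forall>h. ipZ (b h y) z = ipH h v"
    by (rule H.riesz_representation[OF onb])
  then show ?thesis
    unfolding bframe_product_def by (rule theI'[THEN spec])
qed

text \<open>Conjugating the defining identity at \<open>h = e j\<close> turns coefficients against
  the family into basis coordinates of the b-frame product.\<close>

lemma ip_fam: "ipZ z (b (e j) y) = ipH (prod_b z y) (e j)"
  by (metis bframe_product_spec H.ip_commute Z.ip_commute)

lemma has_sum_norm_bframe_product:
  "((\<lambda>j. (norm (ipZ z (b (e j) y)))\<^sup>2) has_sum (norm (prod_b z y))\<^sup>2) K"
  unfolding ip_fam by (rule H.parseval[OF onb])

text \<open>The bounded linear map \<open>\<lambda>h. b h y\<close> is applied termwise to the basis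
  expansion of the b-frame product.\<close>

lemma has_sum_b_bframe_product:
  "((\<lambda>j. sZ (ipZ z (b (e j) y)) (b (e j) y)) has_sum b (prod_b z y) y) K"
  using has_sum_bounded_linear[OF bounded_linear_b H.orthonormal_basis_expansion[OF onb]]
  by (simp add: ip_fam b_scale)

text \<open>Tonelli's theorem combined with Parseval for the inner sum. Stated for
  \<open>has_sum\<close>, it transfers summability and value at once.\<close>

lemma has_sum_sq_fam_iff:
  "((\<lambda>i. (norm (ipZ z (fam i)))\<^sup>2) has_sum s) (K \<times> K) \<longleftrightarrow>
   ((\<lambda>k. (norm (prod_b z (x k)))\<^sup>2) has_sum s) K"
proof -
  \<comment> \<open>The indices are swapped so that the inner sum runs over the basis.\<close>
  let ?g = "\<lambda>(k, j). (norm (ipZ z (b (e j) (x k))))\<^sup>2"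
  have inner: "((\<lambda>j. ?g (k, j)) has_sum (norm (prod_b z (x k)))\<^sup>2) K" for k
    by (simp add: has_sum_norm_bframe_product)
  have "((\<lambda>i. (norm (ipZ z (fam i)))\<^sup>2) has_sum s) (K \<times> K) \<longleftrightarrow> (?g has_sum s) (K \<times> K)"
    by (subst has_sum_swap) (simp add: case_prod_unfold)
  also have "\<dots> \<longleftrightarrow> ((\<lambda>k. (norm (prod_b z (x k)))\<^sup>2) has_sum s) K"
  proof
    show "((\<lambda>k. (norm (prod_b z (x k)))\<^sup>2) has_sum s) K" if "(?g has_sum s) (K \<times> K)"
      using that inner by (rule has_sum_SigmaD)
    \<comment> \<open>Passing from iterated to joint summation needs the terms to be
      nonnegative.\<close>
    show "(?g has_sum s) (K \<times> K)" if s: "((\<lambda>k. (norm (prod_b z (x k)))\<^sup>2) has_sum s) K"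
      using inner s summable_on_SigmaI[OF inner has_sum_imp_summable[OF s]]
      by (intro has_sum_SigmaI) auto
  qed
  finally show ?thesis .
qed

lemma summable_sq_fam_iff:
  "(\<lambda>i. (norm (ipZ z (fam i)))\<^sup>2) summable_on (K \<times> K) \<longleftrightarrow>
   (\<lambda>k. (norm (prod_b z (x k)))\<^sup>2) summable_on K"
  by (simp only: summable_on_def has_sum_sq_fam_iff)

lemma infsum_sq_fam:
  "(\<Sum>\<^sub>\<infinity>i\<in>K \<times> K. (norm (ipZ z (fam i)))\<^sup>2) = (\<Sum>\<^sub>\<infinity>k\<in>K. (norm (prod_b z (x k)))\<^sup>2)"
proof (cases "(\<lambda>k. (norm (prod_b z (x k)))\<^sup>2) summable_on K")
  case True
  then show ?thesis
    by (intro infsumI) (simp only: has_sum_sq_fam_iff has_sum_infsum)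
next
  \<comment> \<open>Neither family is summable, so both infinite sums take the default value
    0.\<close>
  case False
  then show ?thesis
    by (simp only: infsum_not_exists summable_sq_fam_iff not_False_eq_True)
qed

lemma bframe_iff_frame: "bframe sH sB sZ ipH ipZ K x b A B \<longleftrightarrow> frame ipZ (K \<times> K) fam A B"
  by (simp only: bframe_def frame_def summable_sq_fam_iff infsum_sq_fam bil simp_thms)

text \<open>Passing from the joint series to the iterated one requires no absolute convergence. The
  converse is obtained later from uniqueness of the operator.\<close>

lemma frame_op_imp_bframe_op:
  assumes "is_frame_operator sZ ipZ (K \<times> K) fam S"
  shows "is_bframe_operator ipH ipZ K x b S"
  unfolding is_bframe_operator_def
proof
  fix z
  let ?g = "\<lambda>(k, j). sZ (ipZ z (b (e j) (x k))) (b (e j) (x k))"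
  have "((\<lambda>i. sZ (ipZ z (fam i)) (fam i)) has_sum S z) (K \<times> K)"
    using assms by (simp add: is_frame_operator_def)
  then have "(?g has_sum S z) (K \<times> K)"
    by (subst (asm) has_sum_swap) (simp add: case_prod_unfold)
  then show "((\<lambda>k. b (prod_b z (x k)) (x k)) has_sum S z) K"
    by (rule has_sum_SigmaD) (simp add: has_sum_b_bframe_product)
qed

end

section \<open>Uniqueness of the b-frame operator and the canonical dual\<close>

lemma is_bframe_operator_unique:
  assumes "is_bframe_operator ipH ipZ K x b S" and "is_bframe_operator ipH ipZ K x b S'"
  shows "S = S'"
  using assms has_sum_unique unfolding is_bframe_operator_def by blast

theorem proposition2p1:
  fixes sH :: "'k::real_or_complex \<Rightarrow> 'h::banach \<Rightarrow> 'h"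
    and sB :: "'k \<Rightarrow> 'b::banach \<Rightarrow> 'b"
    and sZ :: "'k \<Rightarrow> 'z::banach \<Rightarrow> 'z"
    and ipH :: "'h \<Rightarrow> 'h \<Rightarrow> 'k"
    and ipZ :: "'z \<Rightarrow> 'z \<Rightarrow> 'k"
    and b :: "'h \<Rightarrow> 'b \<Rightarrow> 'z"
    and K :: "'i set"
    and e :: "'i \<Rightarrow> 'h"
    and x :: "'i \<Rightarrow> 'b"
    and A B :: real
  assumes "normed_space_over sB"
    and "hilbert_space_over sH ipH" and "separable_space (euclidean :: 'h topology)"
    and "hilbert_space_over sZ ipZ" and "separable_space (euclidean :: 'z topology)"
    and "continuous_bilinear sH sB sZ b"
    and "countable K"
    and "orthonormal_basis sH ipH K e"
    and "A > 0" and "B > 0"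
  shows
    "(bframe sH sB sZ ipH ipZ K x b A B \<longleftrightarrow>
        frame ipZ (K \<times> K) (\<lambda>(j, k). b (e j) (x k)) A B) \<and>
     (bframe sH sB sZ ipH ipZ K x b A B \<longrightarrow>
        (\<forall>S. is_bframe_operator ipH ipZ K x b S \<longleftrightarrow>
             is_frame_operator sZ ipZ (K \<times> K) (\<lambda>(j, k). b (e j) (x k)) S) \<and>
        (let b' = canonical_dual_map ipH ipZ K x b in
           bframe sH sB sZ ipH ipZ K x b' (inverse B) (inverse A) \<and>
           (\<forall>z. ((\<lambda>k. b' (bframe_product ipH ipZ b z (x k)) (x k)) has_sum z) K \<and>
                ((\<lambda>k. b (bframe_product ipH ipZ b' z (x k)) (x k)) has_sum z) K)))"
proof -
  interpret bframe_setting sH ipH sZ ipZ sB b K e x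
    by (intro bframe_setting.intro bframe_setting_axioms.intro assms)
  show ?thesis
  proof (intro conjI impI)
    show "bframe sH sB sZ ipH ipZ K x b A B \<longleftrightarrow> frame ipZ (K \<times> K) fam A B"
      by (rule bframe_iff_frame)
  next
    assume "bframe sH sB sZ ipH ipZ K x b A B"
    then interpret F: hilbert_frame sZ ipZ "K \<times> K" fam A B
      by unfold_locales (simp only: bframe_iff_frame)
    have bop: "is_bframe_operator ipH ipZ K x b F.frame_op"
      by (rule frame_op_imp_bframe_op) (simp only: F.is_frame_operator_iff)
    then have bop_iff: "is_bframe_operator ipH ipZ K x b S \<longleftrightarrow> S = F.frame_op" for S
      using is_bframe_operator_unique by blast
    then show "\<forall>S. is_bframe_operator ipH ipZ K x b S \<longleftrightarrow>
        is_frame_operator sZ ipZ (K \<times> K) fam S"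
      by (simp only: F.is_frame_operator_iff) simp
    \<comment> \<open>By \<open>bop_iff\<close> the \<open>THE\<close> in
      \<open>bframe_operator\<close> evaluates to the frame operator.\<close>
    have "canonical_dual_map ipH ipZ K x b = (\<lambda>h y. F.inv_op (b h y))"
      by (intro ext) (simp add: canonical_dual_map_def bframe_operator_def bop_iff)
    \<comment> \<open>Self-adjointness moves the inverse from \<open>b h y\<close> onto
      \<open>z\<close>, so both descriptions under \<open>THE\<close> coincide.\<close>
    moreover have dual_prod:
      "bframe_product ipH ipZ (\<lambda>h y. F.inv_op (b h y)) z y = prod_b (F.inv_op z) y" for z y
      by (simp add: bframe_product_def F.inv_op_adjoint)
    moreover have "continuous_bilinear sH sB sZ (\<lambda>h y. F.inv_op (b h y))"
      using bil F.linear_inv_op F.bounded_linear_inv_op by (rule continuous_bilinear_compose)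
    \<comment> \<open>By \<open>dual_prod\<close> the squares for the dual map sum to
      \<open>F.sqsum (F.inv_op z)\<close>.\<close>
    then have "bframe sH sB sZ ipH ipZ K x (\<lambda>h y. F.inv_op (b h y)) (inverse B) (inverse A)"
      using assms F.sqsum_summable F.sqsum_inv_op_ge F.sqsum_inv_op_le
      unfolding bframe_def dual_prod summable_sq_fam_iff infsum_sq_fam by simp
    moreover have sum_b: "((\<lambda>k. b (prod_b z (x k)) (x k)) has_sum F.frame_op z) K" for z
      using bop by (simp add: is_bframe_operator_def)
    \<comment> \<open>The first reconstruction applies the inverse termwise to the series of the
      frame operator; the second evaluates that series at \<open>F.inv_op z\<close>.\<close>
    have "((\<lambda>k. F.inv_op (b (prod_b z (x k)) (x k))) has_sum z) K" for z
      using has_sum_bounded_linear[OF F.bounded_linear_inv_op sum_b] by simp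
    moreover have "((\<lambda>k. b (prod_b (F.inv_op z) (x k)) (x k)) has_sum z) K" for z
      using sum_b[of "F.inv_op z"] by simp
    ultimately show "let b' = canonical_dual_map ipH ipZ K x b in
           bframe sH sB sZ ipH ipZ K x b' (inverse B) (inverse A) \<and>
           (\<forall>z. ((\<lambda>k. b' (bframe_product ipH ipZ b z (x k)) (x k)) has_sum z) K \<and>
                ((\<lambda>k. b (bframe_product ipH ipZ b' z (x k)) (x k)) has_sum z) K)"
      by (simp add: Let_def)
  qed
qed

end
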